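(* Let $f,c,g$ satisfy the standing assumptions, and consider a sequence $\{x^k\}_{k\in\mathbb{N}}$ of iterates generated by the safeguarded implicit augmented Lagrangian method (described in the context) with $\epsilon=0$ and $\varepsilon_k\to 0$. Let $x^\ast\in\mathbb{R}^n$ be an accumulation point of $\{x^k\}_{k\in\mathbb{N}}$ and let $\{x^k\}_{k\in K}$ be a subsequence converging $\varphi$-attentively to $x^\ast$, i.e. $x^k\to_K x^\ast$ and $\varphi(x^k)\to_K\varphi(x^\ast)$ with $\varphi(x^\ast)$ finite. Then $x^\ast$ is an AKKT-stationary point for the problem of minimizing $\varphi=f+g\circ c$ over $\mathbb{R}^n$.
   Context: Write $\overline{\mathbb{R}}=\mathbb{R}\cup\{\infty\}$. Problem: minimize $\varphi(x):=f(x)+g(c(x))$ over $x\in\mathbb{R}^n$. Standing assumptions: $f:\mathbb{R}^n\to\mathbb{R}$ and $c:\mathbb{R}^n\to\mathbb{R}^m$ are continuously differentiable ($c'(x)$ denotes the Jacobian of $c$); $g:\mathbb{R}^m\to\overline{\mathbb{R}}$ is proper, lower semicontinuous and prox-bounded (i.e. $g+\|\cdot\|^2/(2\gamma)$ is bounded below for some $\gamma>0$; the supremum of such $\gamma$ is the threshold $\gamma_g\in(0,\infty]$); $\inf\varphi\in\mathbb{R}$. A point $x$ is feasible if $c(x)\in\operatorname{dom}g$. Attentive convergence: for $h$ proper lsc and $h(\bar x)$ finite, $x^k\overset{h}{\to}\bar x$ means $x^k\to\bar x$ and $h(x^k)\to h(\bar x)$. Regular subdifferential: $v\in\hat\partial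 h(\bar x)$ iff $\liminf_{x\to\bar x,x\ne\bar x}\frac{h(x)-h(\bar x)-\langle v,x-\bar x\rangle}{\|x-\bar x\|}\ge 0$. Limiting subdifferential: $v\in\partial h(\bar x)$ iff $\bar x\in\operatorname{dom}h$ and there are $x^k\overset{h}{\to}\bar x$, $v^k\in\hat\partial h(x^k)$, $v^k\to v$. AKKT-stationarity: a feasible point $x^\ast$ is AKKT-stationary if there exist sequences $\{x^k\}\subseteq\mathbb{R}^n$, $\{y^k\},\{z^k\}\subseteq\mathbb{R}^m$ with $x^k\to x^\ast$, $z^k\overset{g}{\to}c(x^\ast)$, $\nabla f(x^k)+c'(x^k)^\top y^k\to 0$, $y^k\in\partial g(z^k)$ for all $k$, and $c(x^k)-z^k\to 0$. Augmented Lagrangians: for $\mu>0$, $\mathcal{L}^{S}_\mu(x,z,y):=f(x)+g(z)+\langle y,c(x)-z\rangle+\frac{1}{2\mu}\|c(x)-z\|^2$, $\ \mathcal{L}_\mu(x,y):=\inf_{z}\mathcal{L}^S_\mu(x,z,y)$, $\ \mathbf{O}_\mu(x,y):=\operatorname{argmin}_z\mathcal{L}^S_\mu(x,z,y)=\operatorname{prox}_{\mu g}(c(x)+\mu y)$, where $\operatorname{prox}_{\mu g}(v)=\operatorname{argmin}_z\{g(z)+\frac1{2\mu}\|z-v\|^2\}$. Given $\varepsilon\ge0$ and $\hat y$, a pair $(x,z)$ is $\varepsilon$-$\Upsilon$-stationary for $\mathcal{L}_\mu(\cdot,\hat y)$ if $z\in\mathbf{O}_\mu(x,\hat y)$ and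 there is $v\in\mathbb{R}^n$ with $\|v\|\le\varepsilon$ and $(v,0)\in\partial P(x,z)$, where $P(x,z):=\mathcal{L}^S_\mu(x,z,\hat y)$. Safeguarded implicit augmented Lagrangian method with tolerance $\epsilon\ge0$: select $\mu_0\in(0,\gamma_g)$, $\theta,\kappa\in(0,1)$, and a nonempty bounded set $Y\subset\mathbb{R}^m$. For $k=0,1,2,\dots$: (1) select any $\hat y^k\in Y$ and $\varepsilon_k\ge0$; (2) compute an $\varepsilon_k$-$\Upsilon$-stationary pair $(x^k,z^k)$ for $\mathcal{L}_{\mu_k}(\cdot,\hat y^k)$; (3) set $y^k:=\hat y^k+\mu_k^{-1}[c(x^k)-z^k]$ and $V^k:=\|c(x^k)-z^k\|$; (4) if $\max\{\varepsilon_k,V^k\}\le\epsilon$, stop and return $x^k$; (5) if $k=0$ or $V^k\le\theta V^{k-1}$ set $\mu_{k+1}:=\mu_k$, otherwise $\mu_{k+1}:=\kappa\mu_k$. The method is assumed well defined, i.e. step (2) is always possible, and to generate an infinite sequence. *)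

theory Defs
  imports "HOL-Analysis.Analysis"
begin

section \<open>Extended-real-valued functions\<close>

text \<open>Functions into the reals extended by plus infinity are rendered as \<open>ereal\<close>-valued functions;
  properness excludes the value \<open>-\<infinity>\<close>.\<close>

definition edom :: "('a \<Rightarrow> ereal) \<Rightarrow> 'a set" where
  "edom h = {x. h x < \<infinity>}"

definition proper :: "('a \<Rightarrow> ereal) \<Rightarrow> bool" where
  "proper h \<longleftrightarrow> (\<forall>x. h x \<noteq> -\<infinity>) \<and> edom h \<noteq> {}"

definition lower_semicontinuous :: "('a::topological_space \<Rightarrow> ereal) \<Rightarrow> bool" where
  "lower_semicontinuous h \<longleftrightarrow> (\<forall>x. h x \<le> Liminf (at x) h)"

definition prox_bounded_at :: "('a::real_normed_vector \<Rightarrow> ereal) \<Rightarrow> real \<Rightarrow> bool" where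
  "prox_bounded_at h \<gamma> \<longleftrightarrow>
     \<gamma> > 0 \<and> (\<exists>b::real. \<forall>z. ereal b \<le> h z + ereal ((norm z)\<^sup>2 / (2 * \<gamma>)))"

definition prox_bounded :: "('a::real_normed_vector \<Rightarrow> ereal) \<Rightarrow> bool" where
  "prox_bounded h \<longleftrightarrow> (\<exists>\<gamma>. prox_bounded_at h \<gamma>)"

definition prox_threshold :: "('a::real_normed_vector \<Rightarrow> ereal) \<Rightarrow> ereal" where
  "prox_threshold h = Sup (ereal ` {\<gamma>. prox_bounded_at h \<gamma>})"

definition attentive_tendsto ::
  "('a::topological_space \<Rightarrow> ereal) \<Rightarrow> (nat \<Rightarrow> 'a) \<Rightarrow> 'a \<Rightarrow> bool" where
  "attentive_tendsto h X x \<longleftrightarrow>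
     \<bar>h x\<bar> \<noteq> \<infinity> \<and> X \<longlonglongrightarrow> x \<and> (\<lambda>k. h (X k)) \<longlonglongrightarrow> h x"

text \<open>Both subdifferentials are empty at points where \<open>h\<close> is not finite.\<close>

definition regular_subdiff :: "('a::real_inner \<Rightarrow> ereal) \<Rightarrow> 'a \<Rightarrow> 'a set" where
  "regular_subdiff h x =
     {v. \<bar>h x\<bar> \<noteq> \<infinity> \<and>
         0 \<le> Liminf (at x) (\<lambda>x'. (h x' - h x - ereal (v \<bullet> (x' - x))) / ereal (norm (x' - x)))}"

definition limiting_subdiff :: "('a::real_inner \<Rightarrow> ereal) \<Rightarrow> 'a \<Rightarrow> 'a set" where
  "limiting_subdiff h x =
     {v. x \<in> edom h \<and>
         (\<exists>X W. attentive_tendsto h X x \<and> (\<forall>k. W k \<in> regular_subdiff h (X k)) \<and> W \<longlonglongrightarrow> v)}"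

section \<open>Smooth data\<close>

definition continuously_differentiable ::
  "('a::real_normed_vector \<Rightarrow> 'b::real_normed_vector) \<Rightarrow> bool" where
  "continuously_differentiable F \<longleftrightarrow>
     (\<exists>F'. (\<forall>x. (F has_derivative blinfun_apply (F' x)) (at x)) \<and> continuous_on UNIV F')"

definition gradient :: "('a::real_inner \<Rightarrow> real) \<Rightarrow> 'a \<Rightarrow> 'a" where
  "gradient f x = (THE d. GDERIV f x :> d)"

section \<open>The composite problem\<close>

definition composite_obj ::
  "('a \<Rightarrow> real) \<Rightarrow> ('b \<Rightarrow> ereal) \<Rightarrow> ('a \<Rightarrow> 'b) \<Rightarrow> 'a \<Rightarrow> ereal" where
  "composite_obj f g c x = ereal (f x) + g (c x)"

definition standing_assumptions ::
  "(real^'n \<Rightarrow> real) \<Rightarrow> (real^'m \<Rightarrow> ereal) \<Rightarrow> (real^'n \<Rightarrow> real^'m) \<Rightarrow> bool" where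
  "standing_assumptions f g c \<longleftrightarrow>
     continuously_differentiable f \<and> continuously_differentiable c \<and>
     proper g \<and> lower_semicontinuous g \<and> prox_bounded g \<and>
     \<bar>INF x. composite_obj f g c x\<bar> \<noteq> \<infinity>"

definition feasible :: "('b \<Rightarrow> ereal) \<Rightarrow> ('a \<Rightarrow> 'b) \<Rightarrow> 'a \<Rightarrow> bool" where
  "feasible g c x \<longleftrightarrow> c x \<in> edom g"

definition AKKT_stationary ::
  "(real^'n \<Rightarrow> real) \<Rightarrow> (real^'m \<Rightarrow> ereal) \<Rightarrow> (real^'n \<Rightarrow> real^'m) \<Rightarrow> real^'n \<Rightarrow> bool" where
  "AKKT_stationary f g c xs \<longleftrightarrow>
     feasible g c xs \<and>
     (\<exists>x y z.
        x \<longlonglongrightarrow> xs \<and>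
        attentive_tendsto g z (c xs) \<and>
        (\<lambda>k. gradient f (x k) + transpose (jacobian c (at (x k))) *v y k) \<longlonglongrightarrow> 0 \<and>
        (\<forall>k. y k \<in> limiting_subdiff g (z k)) \<and>
        (\<lambda>k. c (x k) - z k) \<longlonglongrightarrow> 0)"

section \<open>Augmented Lagrangian and the method\<close>

definition aug_lagrangian ::
  "(real^'n \<Rightarrow> real) \<Rightarrow> (real^'m \<Rightarrow> ereal) \<Rightarrow> (real^'n \<Rightarrow> real^'m) \<Rightarrow> real \<Rightarrow>
   real^'n \<Rightarrow> real^'m \<Rightarrow> real^'m \<Rightarrow> ereal" where
  "aug_lagrangian f g c \<mu> x z y =
     ereal (f x) + g z + ereal (y \<bullet> (c x - z)) + ereal (1 / (2 * \<mu>) * (norm (c x - z))\<^sup>2)"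

definition oracle_set ::
  "(real^'n \<Rightarrow> real) \<Rightarrow> (real^'m \<Rightarrow> ereal) \<Rightarrow> (real^'n \<Rightarrow> real^'m) \<Rightarrow> real \<Rightarrow>
   real^'n \<Rightarrow> real^'m \<Rightarrow> (real^'m) set" where
  "oracle_set f g c \<mu> x y =
     {z. is_arg_min (\<lambda>z. aug_lagrangian f g c \<mu> x z y) (\<lambda>_. True) z}"

definition Upsilon_stationary ::
  "(real^'n \<Rightarrow> real) \<Rightarrow> (real^'m \<Rightarrow> ereal) \<Rightarrow> (real^'n \<Rightarrow> real^'m) \<Rightarrow> real \<Rightarrow> real^'m \<Rightarrow>
   real \<Rightarrow> real^'n \<Rightarrow> real^'m \<Rightarrow> bool" where
  "Upsilon_stationary f g c \<mu> yh \<epsilon> x z \<longleftrightarrow>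
     z \<in> oracle_set f g c \<mu> x yh \<and>
     (\<exists>v. norm v \<le> \<epsilon> \<and>
          (v, 0) \<in> limiting_subdiff (\<lambda>(x', z'). aug_lagrangian f g c \<mu> x' z' yh) (x, z))"

text \<open>An infinite run of the method with tolerance \<open>tol\<close>: the stopping test fails in every iteration.
  The method chooses \<open>yh k\<close> and \<open>\<epsilon> k\<close> freely, and \<open>(x k, z k)\<close> is any admissible pair.\<close>

definition safeguarded_ialm_run ::
  "(real^'n \<Rightarrow> real) \<Rightarrow> (real^'m \<Rightarrow> ereal) \<Rightarrow> (real^'n \<Rightarrow> real^'m) \<Rightarrow> real \<Rightarrow>
   real \<Rightarrow> real \<Rightarrow> (real^'m) set \<Rightarrow> (nat \<Rightarrow> real) \<Rightarrow> (nat \<Rightarrow> real^'m) \<Rightarrow> (nat \<Rightarrow> real) \<Rightarrow>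
   (nat \<Rightarrow> real^'n) \<Rightarrow> (nat \<Rightarrow> real^'m) \<Rightarrow> (nat \<Rightarrow> real^'m) \<Rightarrow> (nat \<Rightarrow> real) \<Rightarrow> bool" where
  "safeguarded_ialm_run f g c tol \<theta> \<kappa> Y \<mu> yh \<epsilon> x z y V \<longleftrightarrow>
     0 \<le> tol \<and>
     0 < \<mu> 0 \<and> ereal (\<mu> 0) < prox_threshold g \<and>
     \<theta> \<in> {0<..<1} \<and> \<kappa> \<in> {0<..<1} \<and>
     Y \<noteq> {} \<and> bounded Y \<and>
     (\<forall>k. yh k \<in> Y \<and> 0 \<le> \<epsilon> k \<and>
          Upsilon_stationary f g c (\<mu> k) (yh k) (\<epsilon> k) (x k) (z k) \<and>
          y k = yh k + inverse (\<mu> k) *\<^sub>R (c (x k) - z k) \<and>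
          V k = norm (c (x k) - z k) \<and>
          \<not> max (\<epsilon> k) (V k) \<le> tol \<and>
          \<mu> (Suc k) = (if k = 0 \<or> V k \<le> \<theta> * V (k - 1) then \<mu> k else \<kappa> * \<mu> k))"

end

theory Submission
  imports Defs
begin

text \<open>
  The subsequence itself, together with its companions \<open>z\<close> and \<open>y\<close>, witnesses AKKT-stationarity.

  Dual part. The augmented Lagrangian is a continuously differentiable function of the pair
  \<open>(x, z)\<close> plus \<open>g z\<close>. A subgradient \<open>(v, 0)\<close> of it therefore splits
  (\<open>limiting_subdiff_aug_lagrangian\<close>): its first component is the gradient in \<open>x\<close> of the smooth
  part, which is the gradient of \<open>f\<close> plus the transposed Jacobian of \<open>c\<close> applied to the updated
  multiplier, and its second component says that this multiplier is a limiting subgradient of \<open>g\<close>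
  at \<open>z\<close>. Since \<open>norm v \<le> \<epsilon> k\<close> and \<open>\<epsilon>\<close> tends to zero, so does the dual residual.

  Primal part. The update rule leaves two possibilities (\<open>penalty_or_residual_tendsto_zero\<close>).
  Either the penalty parameter is reduced only finitely often, and then the residuals decay
  geometrically; or \<open>\<mu>\<close> tends to zero. In the second case one compares the minimiser \<open>z\<close>
  with the competitor \<open>c x\<close> in the inner minimisation:
  \<open>g z + yh \<bullet> (c x - z) + (norm (c x - z))\<^sup>2 / (2 * \<mu>) \<le> g (c x)\<close>.
  Attentive convergence bounds the right-hand side, and prox-boundedness keeps \<open>g\<close> above a
  negative quadratic, which the penalty term dominates once \<open>\<mu>\<close> is small; hence the squared
  residual is \<open>O(\<mu>)\<close> (\<open>penalised_residual_bound\<close>).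

  In both cases \<open>z\<close> tends to \<open>c xs\<close>. Dropping the penalty term from the comparison bounds
  \<open>g z\<close> from above by a sequence with limit \<open>g (c xs)\<close>, because the safeguarded multipliers are
  bounded; lower semicontinuity gives the matching lower bound, so that \<open>z\<close> converges
  \<open>g\<close>-attentively.
\<close>

section \<open>Calculus of regular subgradients\<close>

lemma ereal_le_quotient_iff:
  fixes H :: ereal
  assumes "n > 0"
  shows "ereal (- e) \<le> (H - ereal r - ereal s) / ereal n \<longleftrightarrow> ereal r + ereal (s - e * n) \<le> H"
  using assms by (cases H) (auto simp: field_simps)

text \<open>The first-order lower bound with slack \<open>e\<close> avoids difference quotients of extended reals, so
  that sums and restrictions of functions can be treated by real arithmetic.\<close>

lemma regular_subdiff_iff:
  fixes h :: "'a::real_inner \<Rightarrow> ereal"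
  shows "v \<in> regular_subdiff h p \<longleftrightarrow>
    \<bar>h p\<bar> \<noteq> \<infinity> \<and> (\<forall>e>0. \<forall>\<^sub>F q in at p. h p + ereal (v \<bullet> (q - p) - e * norm (q - p)) \<le> h q)"
proof (cases "\<bar>h p\<bar> = \<infinity>")
  case False
  then obtain r where r: "h p = ereal r" by auto
  define Q where "Q q = (h q - h p - ereal (v \<bullet> (q - p))) / ereal (norm (q - p))" for q
  have Q: "ereal (- e) \<le> Q q \<longleftrightarrow> h p + ereal (v \<bullet> (q - p) - e * norm (q - p)) \<le> h q"
    if "q \<noteq> p" for e q
    unfolding Q_def r using that by (intro ereal_le_quotient_iff) auto
  have "0 \<le> Liminf (at p) Q \<longleftrightarrow> (\<forall>e>0. \<forall>\<^sub>F q in at p. ereal (- e) \<le> Q q)"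
  proof
    assume L: "0 \<le> Liminf (at p) Q"
    show "\<forall>e>0. \<forall>\<^sub>F q in at p. ereal (- e) \<le> Q q"
    proof (intro allI impI)
      fix e :: real assume "e > 0"
      then have "ereal (- e) < 0" by simp
      then have "\<forall>\<^sub>F q in at p. ereal (- e) < Q q"
        using L by (auto simp: le_Liminf_iff)
      then show "\<forall>\<^sub>F q in at p. ereal (- e) \<le> Q q"
        by eventually_elim simp
    qed
  next
    assume R: "\<forall>e>0. \<forall>\<^sub>F q in at p. ereal (- e) \<le> Q q"
    show "0 \<le> Liminf (at p) Q"
      unfolding le_Liminf_iff
    proof (intro allI impI)
      fix a :: ereal assume "a < 0"
      then obtain b where b: "a < ereal b" "ereal b < 0"
        using ereal_dense2 by blast
      then have "\<forall>\<^sub>F q in at p. ereal (- (- b)) \<le> Q q"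
        using R[rule_format, of "- b"] by simp
      then show "\<forall>\<^sub>F q in at p. a < Q q"
        by eventually_elim (use b in auto)
    qed
  qed
  also have "\<dots> \<longleftrightarrow>
    (\<forall>e>0. \<forall>\<^sub>F q in at p. h p + ereal (v \<bullet> (q - p) - e * norm (q - p)) \<le> h q)"
    by (intro all_cong1 imp_cong refl eventually_cong) (auto simp: Q eventually_at_filter)
  finally show ?thesis
    using False by (simp add: regular_subdiff_def Q_def[abs_def])
qed (simp add: regular_subdiff_def)

text \<open>Half of the slack absorbs the linearisation error of \<open>F\<close>; the other half is left for \<open>G\<close>.\<close>

lemma regular_subdiff_smooth_sum:
  fixes F :: "'a::real_inner \<Rightarrow> real"
  assumes F: "GDERIV F p :> u"
    and w: "w \<in> regular_subdiff (\<lambda>q. ereal (F q) + G q) p"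
  shows "w - u \<in> regular_subdiff G p"
proof -
  have "\<forall>\<^sub>F q in at p. G p + ereal ((w - u) \<bullet> (q - p) - e * norm (q - p)) \<le> G q"
    if "e > 0" for e
  proof -
    have e2: "e / 2 > 0" using that by simp
    obtain d where d: "d > 0"
      "\<And>q. norm (q - p) < d \<Longrightarrow> norm (F q - F p - (q - p) \<bullet> u) \<le> e / 2 * norm (q - p)"
      using F e2 unfolding gderiv_def has_derivative_at_alt by blast
    have "\<forall>\<^sub>F q in at p. dist q p < d"
      using d(1) by (auto simp: eventually_at)
    moreover have "\<forall>\<^sub>F q in at p.
        ereal (F p) + G p + ereal (w \<bullet> (q - p) - e / 2 * norm (q - p)) \<le> ereal (F q) + G q"
      using w e2 unfolding regular_subdiff_iff by blast
    ultimately show ?thesis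
    proof eventually_elim
      case (elim q)
      have "norm (F q - F p - (q - p) \<bullet> u) \<le> e / 2 * norm (q - p)"
        using d(2) elim(1) by (simp add: dist_norm)
      then have "F q - F p - (q - p) \<bullet> u \<le> e / 2 * norm (q - p)"
        by (simp only: real_norm_def abs_le_iff)
      then show ?case
        using elim(2)
        by (cases "G p"; cases "G q") (auto simp: inner_diff_left inner_diff_right inner_commute)
    qed
  qed
  moreover have "\<bar>G p\<bar> \<noteq> \<infinity>"
    using w unfolding regular_subdiff_iff by (cases "G p") auto
  ultimately show ?thesis unfolding regular_subdiff_iff by blast
qed

text \<open>A function of \<open>z\<close> alone is constant in the direction \<open>(a, 0)\<close>, along which the lower bound would
  force growth at rate \<open>norm a\<close>; hence \<open>a = 0\<close>. Restricting to pairs \<open>(x, z')\<close> gives the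
  claim about \<open>b\<close>.\<close>

lemma regular_subdiff_snd:
  fixes g :: "'b::real_inner \<Rightarrow> ereal" and a x :: "'a::real_inner"
  assumes "(a, b) \<in> regular_subdiff (\<lambda>p. g (snd p)) (x, z)"
  shows "a = 0" and "b \<in> regular_subdiff g z"
proof -
  have fin: "\<bar>g z\<bar> \<noteq> \<infinity>"
    using assms by (simp add: regular_subdiff_iff)
  have near: "\<exists>d>0. \<forall>x' z'. (x', z') \<noteq> (x, z) \<and> dist (x', z') (x, z) < d \<longrightarrow>
      g z + ereal (a \<bullet> (x' - x) + b \<bullet> (z' - z) - e * norm (x' - x, z' - z)) \<le> g z'"
    if "e > 0" for e
    using assms that unfolding regular_subdiff_iff eventually_at
    by (force simp: inner_Pair)
  show "a = 0"
  proof (rule ccontr)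
    assume "a \<noteq> 0"
    then have "norm a / 2 > 0" by simp
    from near[OF this] obtain d where d: "d > 0"
      "\<And>x' z'. (x', z') \<noteq> (x, z) \<Longrightarrow> dist (x', z') (x, z) < d \<Longrightarrow>
        g z + ereal (a \<bullet> (x' - x) + b \<bullet> (z' - z) - norm a / 2 * norm (x' - x, z' - z)) \<le> g z'"
      by blast
    \<comment> \<open>The step \<open>t *\<^sub>R a\<close> has length \<open>d / 2\<close>, so the lower bound applies to it.\<close>
    define t where "t = d / (2 * norm a)"
    have t: "t > 0" using d \<open>a \<noteq> 0\<close> by (simp add: t_def)
    have "g z + ereal (a \<bullet> (x + t *\<^sub>R a - x) + b \<bullet> (z - z)
        - norm a / 2 * norm (x + t *\<^sub>R a - x, z - z)) \<le> g z"
      using d(1) \<open>a \<noteq> 0\<close> t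
      by (intro d(2)) (auto simp: dist_Pair_Pair dist_norm norm_Pair t_def)
    then have "t * (norm a * norm a) - norm a / 2 * (t * norm a) \<le> 0"
      using fin t by (cases "g z") (auto simp: norm_Pair dot_square_norm power2_eq_square)
    then have "t * (norm a * norm a) \<le> 0" by (simp add: field_simps)
    then show False using t \<open>a \<noteq> 0\<close> by (simp add: mult_le_0_iff)
  qed
  have "\<forall>\<^sub>F z' in at z. g z + ereal (b \<bullet> (z' - z) - e * norm (z' - z)) \<le> g z'" if "e > 0" for e
  proof -
    obtain d where d: "d > 0"
      "\<And>x' z'. (x', z') \<noteq> (x, z) \<Longrightarrow> dist (x', z') (x, z) < d \<Longrightarrow>
        g z + ereal (a \<bullet> (x' - x) + b \<bullet> (z' - z) - e * norm (x' - x, z' - z)) \<le> g z'"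
      using near[OF \<open>e > 0\<close>] by blast
    show ?thesis
      unfolding eventually_at
      using d(1) d(2)[of x] by (auto simp: dist_Pair_Pair norm_Pair intro!: exI[of _ d])
  qed
  then show "b \<in> regular_subdiff g z"
    using fin by (simp add: regular_subdiff_iff)
qed

section \<open>Gradients and Jacobians in Euclidean space\<close>

lemma GDERIV_gradient:
  fixes f :: "'a::euclidean_space \<Rightarrow> real"
  assumes "f differentiable (at x)"
  shows "GDERIV f x :> gradient f x"
proof -
  obtain f' where f': "(f has_derivative f') (at x)"
    using assms by (auto simp: differentiable_def)
  have ex: "GDERIV f x :> adjoint f' 1"
    using f' adjoint_works[OF has_derivative_linear[OF f'], of _ 1] by (simp add: gderiv_def)
  show ?thesis
    unfolding gradient_def
  proof (rule theI[where P = "\<lambda>d. GDERIV f x :> d", OF ex])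
    fix d assume "GDERIV f x :> d"
    then have "(\<lambda>h. h \<bullet> d) = (\<lambda>h. h \<bullet> adjoint f' 1)"
      using ex unfolding gderiv_def by (rule has_derivative_unique)
    then show "d = adjoint f' 1"
      by (metis vector_eq_ldot)
  qed
qed

lemma inner_transpose_jacobian:
  fixes c :: "real^'n \<Rightarrow> real^'m"
  assumes "(c has_derivative C) (at x)"
  shows "(transpose (jacobian c (at x)) *v w) \<bullet> h = w \<bullet> C h"
proof -
  have "frechet_derivative c (at x) = C"
    using frechet_derivative_at[OF assms] by simp
  then have "jacobian c (at x) *v h = C h"
    using fun_cong[OF matrix_vector_mul(2)[OF has_derivative_linear[OF assms]], of h]
    by (simp only: jacobian_def)
  then show ?thesis
    by (metis dot_lmul_matrix vector_transpose_matrix transpose_transpose)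
qed

lemma gradient_inner:
  fixes f :: "'a::euclidean_space \<Rightarrow> real"
  assumes "(f has_derivative D) (at x)"
  shows "gradient f x \<bullet> h = D h"
proof -
  have "GDERIV f x :> gradient f x"
    using assms by (intro GDERIV_gradient) (auto simp: differentiable_def)
  then have "(\<lambda>h. h \<bullet> gradient f x) = D"
    using assms unfolding gderiv_def by (rule has_derivative_unique)
  then show ?thesis by (auto simp: inner_commute)
qed

lemma tendsto_gradient:
  fixes f :: "real^'n \<Rightarrow> real"
  assumes "continuously_differentiable f" "X \<longlonglongrightarrow> x"
  shows "(\<lambda>k. gradient f (X k)) \<longlonglongrightarrow> gradient f x"
proof -
  obtain f' where f': "\<And>x. (f has_derivative blinfun_apply (f' x)) (at x)" "continuous_on UNIV f'"
    using assms by (auto simp: continuously_differentiable_def)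
  have "(\<lambda>k. f' (X k)) \<longlonglongrightarrow> f' x"
    using continuous_on_tendsto_compose[OF f'(2) assms(2)] by simp
  then have "(\<lambda>k. gradient f (X k) \<bullet> axis i 1) \<longlonglongrightarrow> gradient f x \<bullet> axis i 1" for i
    unfolding gradient_inner[OF f'(1)] by (intro tendsto_intros)
  then show ?thesis
    by (intro vec_tendstoI) (simp add: inner_axis)
qed

lemma tendsto_transpose_jacobian:
  fixes c :: "real^'n \<Rightarrow> real^'m"
  assumes "continuously_differentiable c" "X \<longlonglongrightarrow> x" "W \<longlonglongrightarrow> w"
  shows "(\<lambda>k. transpose (jacobian c (at (X k))) *v W k) \<longlonglongrightarrow> transpose (jacobian c (at x)) *v w"
proof -
  obtain c' where c': "\<And>x. (c has_derivative blinfun_apply (c' x)) (at x)" "continuous_on UNIV c'"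
    using assms by (auto simp: continuously_differentiable_def)
  have "(\<lambda>k. c' (X k)) \<longlonglongrightarrow> c' x"
    using continuous_on_tendsto_compose[OF c'(2) assms(2)] by simp
  then have "(\<lambda>k. (transpose (jacobian c (at (X k))) *v W k) \<bullet> axis i 1)
      \<longlonglongrightarrow> (transpose (jacobian c (at x)) *v w) \<bullet> axis i 1" for i
    unfolding inner_transpose_jacobian[OF c'(1)] by (intro tendsto_intros assms)
  then show ?thesis
    by (intro vec_tendstoI) (simp add: inner_axis)
qed

lemma continuously_differentiable_tendsto:
  assumes "continuously_differentiable F" "X \<longlonglongrightarrow> x"
  shows "(\<lambda>k. F (X k)) \<longlonglongrightarrow> F x"
  using assms isCont_tendsto_compose has_derivative_continuous
  unfolding continuously_differentiable_def by blast

section \<open>Subgradients of the augmented Lagrangian\<close>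

definition lagrangian_smooth_part ::
  "(real^'n \<Rightarrow> real) \<Rightarrow> (real^'n \<Rightarrow> real^'m) \<Rightarrow> real \<Rightarrow> real^'m \<Rightarrow> (real^'n) \<times> (real^'m) \<Rightarrow> real" where
  "lagrangian_smooth_part f c \<mu> y p =
     f (fst p) + y \<bullet> (c (fst p) - snd p) + 1 / (2 * \<mu>) * (norm (c (fst p) - snd p))\<^sup>2"

lemma aug_lagrangian_split:
  "aug_lagrangian f g c \<mu> x z y = ereal (lagrangian_smooth_part f c \<mu> y (x, z)) + g z"
  unfolding aug_lagrangian_def lagrangian_smooth_part_def
  by (cases "g z") simp_all

text \<open>The quadratic term contributes \<open>inverse \<mu> *\<^sub>R (c x - z)\<close> next to \<open>y\<close>, which is how the
  first-order multiplier update \<open>w\<close> arises.\<close>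

lemma GDERIV_lagrangian_smooth_part:
  fixes f :: "real^'n \<Rightarrow> real" and c :: "real^'n \<Rightarrow> real^'m"
    and y z :: "real^'m"
  assumes f: "f differentiable (at x)" and c: "c differentiable (at x)" and "\<mu> \<noteq> 0"
  defines "w \<equiv> y + inverse \<mu> *\<^sub>R (c x - z)"
  shows "GDERIV (lagrangian_smooth_part f c \<mu> y) (x, z) :>
    (gradient f x + transpose (jacobian c (at x)) *v w, - w)"
proof -
  obtain C where C: "(c has_derivative C) (at x)"
    using c by (auto simp: differentiable_def)
  have f': "(f has_derivative (\<lambda>h. gradient f x \<bullet> h)) (at x)"
    using GDERIV_gradient[OF f] by (simp add: gderiv_def inner_commute)
  have ff: "((\<lambda>p. f (fst p)) has_derivative (\<lambda>h. gradient f x \<bullet> fst h)) (at (x, z))"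
    by (rule has_derivative_compose[OF has_derivative_fst[OF has_derivative_ident]]) (simp add: f')
  have cc: "((\<lambda>p. c (fst p)) has_derivative (\<lambda>h. C (fst h))) (at (x, z))"
    by (rule has_derivative_compose[OF has_derivative_fst[OF has_derivative_ident]]) (simp add: C)
  have S: "(lagrangian_smooth_part f c \<mu> y has_derivative
      (\<lambda>h. gradient f x \<bullet> fst h + y \<bullet> (C (fst h) - snd h)
        + 1 / (2 * \<mu>) * ((c x - z) \<bullet> (C (fst h) - snd h) + (C (fst h) - snd h) \<bullet> (c x - z)))) (at (x, z))"
    unfolding lagrangian_smooth_part_def[abs_def] power2_norm_eq_inner
    by (rule has_derivative_eq_rhs, (rule derivative_intros ff cc)+) simp
  have "gradient f x \<bullet> fst h + y \<bullet> (C (fst h) - snd h)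
        + 1 / (2 * \<mu>) * ((c x - z) \<bullet> (C (fst h) - snd h) + (C (fst h) - snd h) \<bullet> (c x - z))
      = h \<bullet> (gradient f x + transpose (jacobian c (at x)) *v w, - w)" for h
  proof -
    have "1 / (2 * \<mu>) * ((c x - z) \<bullet> (C (fst h) - snd h) + (C (fst h) - snd h) \<bullet> (c x - z))
        = inverse \<mu> * ((c x - z) \<bullet> (C (fst h) - snd h))"
      using \<open>\<mu> \<noteq> 0\<close> by (simp add: inner_commute field_simps)
    then have "gradient f x \<bullet> fst h + y \<bullet> (C (fst h) - snd h)
        + 1 / (2 * \<mu>) * ((c x - z) \<bullet> (C (fst h) - snd h) + (C (fst h) - snd h) \<bullet> (c x - z))
      = gradient f x \<bullet> fst h + w \<bullet> (C (fst h) - snd h)"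
      by (simp add: w_def inner_add_left)
    also have "\<dots> = fst h \<bullet> gradient f x
        + (transpose (jacobian c (at x)) *v w) \<bullet> fst h - w \<bullet> snd h"
      by (simp del: transpose_matrix_vector add: inner_transpose_jacobian[OF C] inner_diff_right
          inner_commute[of "gradient f x"])
    also have "\<dots> = h \<bullet> (gradient f x + transpose (jacobian c (at x)) *v w, - w)"
      by (cases h) (simp add: inner_Pair inner_add_right inner_commute)
    finally show ?thesis .
  qed
  then show ?thesis
    using S by (simp add: gderiv_def)
qed

text \<open>The splitting holds exactly for regular subgradients at the approximating points. It survives the
  limit because the derivatives of \<open>f\<close> and \<open>c\<close> are continuous, and because attentive convergence
  for the sum is attentive convergence for \<open>g\<close> once the continuous smooth part is subtracted.\<close>

lemma limiting_subdiff_aug_lagrangian: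
  fixes f :: "real^'n \<Rightarrow> real" and c :: "real^'n \<Rightarrow> real^'m" and g :: "real^'m \<Rightarrow> ereal"
    and y z :: "real^'m"
  assumes f: "continuously_differentiable f" and c: "continuously_differentiable c"
    and "\<mu> \<noteq> 0"
    and v: "(v, 0) \<in> limiting_subdiff (\<lambda>(x', z'). aug_lagrangian f g c \<mu> x' z' y) (x, z)"
  defines "w \<equiv> y + inverse \<mu> *\<^sub>R (c x - z)"
  shows "w \<in> limiting_subdiff g z" and "v = gradient f x + transpose (jacobian c (at x)) *v w"
proof -
  define S where "S = lagrangian_smooth_part f c \<mu> y"
  define P where "P = (\<lambda>p. ereal (S p) + g (snd p))"
  have P_eq: "(\<lambda>(x', z'). aug_lagrangian f g c \<mu> x' z' y) = P"
    by (auto simp: P_def S_def aug_lagrangian_split)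
  obtain Q W where Q: "attentive_tendsto P Q (x, z)"
    and W: "\<And>k. W k \<in> regular_subdiff P (Q k)" and Wlim: "W \<longlonglongrightarrow> (v, 0)"
    using v unfolding P_eq limiting_subdiff_def by auto
  define X Z where "X k = fst (Q k)" and "Z k = snd (Q k)" for k
  define U where "U k = y + inverse \<mu> *\<^sub>R (c (X k) - Z k)" for k
  have X: "X \<longlonglongrightarrow> x" and Z: "Z \<longlonglongrightarrow> z"
    using Q tendsto_fst[of Q "(x, z)"] tendsto_snd[of Q "(x, z)"]
    unfolding attentive_tendsto_def X_def Z_def by auto
  have cX: "(\<lambda>k. c (X k)) \<longlonglongrightarrow> c x" and fX: "(\<lambda>k. f (X k)) \<longlonglongrightarrow> f x"
    using X f c continuously_differentiable_tendsto by blast+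
  have U: "U \<longlonglongrightarrow> w"
    unfolding U_def w_def by (intro tendsto_intros cX Z)
  have diff: "f differentiable (at u)" "c differentiable (at u)" for u
    using f c by (auto simp: continuously_differentiable_def differentiable_def)
  define D where "D k = W k - (gradient f (X k) + transpose (jacobian c (at (X k))) *v U k, - U k)" for k
  have D: "D k \<in> regular_subdiff (\<lambda>p. g (snd p)) (X k, Z k)" for k
    using regular_subdiff_smooth_sum[OF GDERIV_lagrangian_smooth_part[OF diff[of "X k"] \<open>\<mu> \<noteq> 0\<close>],
        of "W k" y "\<lambda>p. g (snd p)" "Z k"] W[of k]
    by (simp add: D_def U_def P_def S_def X_def Z_def)
  have "fst (D k) = 0" and "snd (D k) \<in> regular_subdiff g (Z k)" for k
    using regular_subdiff_snd[where a = "fst (D k)" and b = "snd (D k)" and g = g] D[of k]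
    unfolding prod.collapse by blast+
  then have Wfst: "fst (W k) = gradient f (X k) + transpose (jacobian c (at (X k))) *v U k"
    and Wsnd: "snd (W k) + U k \<in> regular_subdiff g (Z k)" for k
    by (auto simp: D_def)
  have "(\<lambda>k. fst (W k)) \<longlonglongrightarrow> gradient f x + transpose (jacobian c (at x)) *v w"
    unfolding Wfst
    by (intro tendsto_add tendsto_gradient tendsto_transpose_jacobian f c X U)
  moreover have "(\<lambda>k. fst (W k)) \<longlonglongrightarrow> v"
    using tendsto_fst[OF Wlim] by simp
  ultimately show "v = gradient f x + transpose (jacobian c (at x)) *v w"
    using LIMSEQ_unique by blast
  have SQ: "(\<lambda>k. S (Q k)) \<longlonglongrightarrow> S (x, z)"
    unfolding S_def lagrangian_smooth_part_def
    using fX cX Z \<open>\<mu> \<noteq> 0\<close> unfolding X_def Z_def by (auto intro!: tendsto_intros)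
  have PQ: "(\<lambda>k. P (Q k)) \<longlonglongrightarrow> P (x, z)" and Pfin: "\<bar>P (x, z)\<bar> \<noteq> \<infinity>"
    using Q by (auto simp: attentive_tendsto_def)
  have "(\<lambda>k. P (Q k) - ereal (S (Q k))) \<longlonglongrightarrow> P (x, z) - ereal (S (x, z))"
    using PQ SQ by (intro tendsto_diff_ereal_general) auto
  moreover have "P p - ereal (S p) = g (snd p)" for p
    by (cases "g (snd p)") (auto simp: P_def)
  ultimately have gZ: "(\<lambda>k. g (Z k)) \<longlonglongrightarrow> g z"
    by (simp add: Z_def)
  have gfin: "\<bar>g z\<bar> \<noteq> \<infinity>"
    using Pfin by (cases "g z") (auto simp: P_def)
  have "(\<lambda>k. snd (W k) + U k) \<longlonglongrightarrow> 0 + w"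
    using tendsto_snd[OF Wlim] U by (intro tendsto_add) auto
  with gfin gZ Z Wsnd have "attentive_tendsto g Z z \<and>
      (\<forall>k. snd (W k) + U k \<in> regular_subdiff g (Z k)) \<and> (\<lambda>k. snd (W k) + U k) \<longlonglongrightarrow> w"
    by (auto simp: attentive_tendsto_def)
  then have "\<exists>X W. attentive_tendsto g X z \<and> (\<forall>k. W k \<in> regular_subdiff g (X k)) \<and> W \<longlonglongrightarrow> w"
    by (rule exI[of _ Z, OF exI[of _ "\<lambda>k. snd (W k) + U k"]])
  moreover have "g z < \<infinity>" using gfin by auto
  ultimately show "w \<in> limiting_subdiff g z"
    by (simp add: limiting_subdiff_def edom_def)
qed

section \<open>Vanishing of the residuals\<close>

text \<open>The competitor \<open>c x\<close> makes both the multiplier term and the penalty term vanish.\<close>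

lemma oracle_set_descent:
  assumes "z \<in> oracle_set f g c \<mu> x y"
  shows "g z + ereal (y \<bullet> (c x - z) + 1 / (2 * \<mu>) * (norm (c x - z))\<^sup>2) \<le> g (c x)"
proof -
  have "aug_lagrangian f g c \<mu> x z y \<le> aug_lagrangian f g c \<mu> x (c x) y"
    using assms by (auto simp: oracle_set_def is_arg_min_linorder)
  then show ?thesis
    by (cases "g z"; cases "g (c x)") (auto simp: aug_lagrangian_def)
qed

text \<open>The sequence \<open>\<mu>\<close> decreases to some \<open>L \<ge> 0\<close>. If \<open>L > 0\<close>, then a reduction from below
  \<open>L / \<kappa>\<close> would undershoot \<open>L\<close>, so reductions stop eventually and \<open>V\<close> contracts by the
  factor \<open>\<theta>\<close> from then on.\<close>

lemma penalty_or_residual_tendsto_zero: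
  fixes \<mu> V :: "nat \<Rightarrow> real"
  assumes \<mu>0: "0 < \<mu> 0" and \<theta>: "0 < \<theta>" "\<theta> < 1" and \<kappa>: "0 < \<kappa>" "\<kappa> < 1"
    and V: "\<And>k. 0 \<le> V k"
    and step: "\<And>k. \<mu> (Suc k) = (if k = 0 \<or> V k \<le> \<theta> * V (k - 1) then \<mu> k else \<kappa> * \<mu> k)"
  shows "\<And>k. 0 < \<mu> k" and "\<mu> \<longlonglongrightarrow> 0 \<or> V \<longlonglongrightarrow> 0"
proof -
  show pos: "0 < \<mu> k" for k
    by (induction k) (use \<mu>0 \<kappa> step in auto)
  have "\<mu> (Suc k) \<le> \<mu> k" for k
    using pos[of k] \<kappa> step[of k] by (auto simp: mult_left_le_one_le)
  then have dec: "decseq \<mu>" by (rule decseq_SucI)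
  then obtain L where L: "\<mu> \<longlonglongrightarrow> L" "\<And>k. L \<le> \<mu> k"
    using decseq_convergent[of \<mu> 0] pos less_imp_le by metis
  have "V \<longlonglongrightarrow> 0" if "\<not> \<mu> \<longlonglongrightarrow> 0"
  proof -
    have "L > 0"
      using that L LIMSEQ_le_const[OF L(1), of 0] pos less_imp_le
      by (metis order_le_less)
    then have "L < L / \<kappa>" using \<kappa> by (simp add: field_simps)
    then obtain N where N: "\<And>k. k \<ge> N \<Longrightarrow> \<mu> k < L / \<kappa>"
      using order_tendstoD(2)[OF L(1)] by (auto simp: eventually_sequentially)
    have V_step: "V (Suc k) \<le> \<theta> * V k" if "k \<ge> N" for k
    proof (rule ccontr)
      assume "\<not> ?thesis"
      then have "\<mu> (Suc (Suc k)) = \<kappa> * \<mu> (Suc k)" using step[of "Suc k"] by simp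
      also have "\<dots> < L" using N[of "Suc k"] that \<kappa> by (simp add: field_simps)
      finally show False using L(2)[of "Suc (Suc k)"] by simp
    qed
    have bound: "V (N + k) \<le> \<theta> ^ k * V N" for k
    proof (induction k)
      case (Suc k)
      have "V (N + Suc k) \<le> \<theta> * V (N + k)" using V_step[of "N + k"] by simp
      also have "\<dots> \<le> \<theta> * (\<theta> ^ k * V N)" using Suc \<theta> by (intro mult_left_mono) auto
      finally show ?case by (simp add: mult.assoc)
    qed simp
    have "(\<lambda>k. \<theta> ^ k * V N) \<longlonglongrightarrow> 0 * V N"
      using \<theta> by (intro tendsto_mult LIMSEQ_power_zero tendsto_const) auto
    then have "(\<lambda>k. V (N + k)) \<longlonglongrightarrow> 0"
      using tendsto_sandwich[of "\<lambda>_. 0" "\<lambda>k. V (N + k)" sequentially "\<lambda>k. \<theta> ^ k * V N" 0]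
      by (simp add: V bound)
    then show ?thesis
      using LIMSEQ_offset[of V N 0] by (simp add: add.commute)
  qed
  then show "\<mu> \<longlonglongrightarrow> 0 \<or> V \<longlonglongrightarrow> 0" by blast
qed

text \<open>Write \<open>V\<close> for the residual. The prox-bound costs at most \<open>M\<^sup>2 / \<gamma> + V\<^sup>2 / \<gamma>\<close> and the multiplier
  term at most \<open>B\<^sup>2 / 2 + V\<^sup>2 / 2\<close>. Multiplying by \<open>2 * \<mu>\<close> leaves the total coefficient
  \<open>2 * \<mu> * (1 / \<gamma> + 1 / 2)\<close> of \<open>V\<^sup>2\<close> on the right, and the smallness condition lets the
  left-hand side absorb it.\<close>

lemma penalised_residual_bound:
  fixes g :: "'b::real_inner \<Rightarrow> ereal" and \<mu> :: real
  assumes "0 < \<mu>" "0 < \<gamma>"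
    and prox: "ereal b \<le> g z + ereal ((norm z)\<^sup>2 / (2 * \<gamma>))"
    and descent: "g z + ereal (y \<bullet> (p - z) + 1 / (2 * \<mu>) * (norm (p - z))\<^sup>2) \<le> ereal G"
    and "norm y \<le> B" "norm p \<le> M"
    and small: "2 * \<mu> * (1 / \<gamma> + 1 / 2) \<le> 1 / 2"
  shows "(norm (p - z))\<^sup>2 \<le> 4 * \<mu> * (B\<^sup>2 / 2 + G - b + M\<^sup>2 / \<gamma>)"
proof -
  define V where "V = norm (p - z)"
  obtain r where r: "g z = ereal r"
    using prox descent by (cases "g z") auto
  have "norm z \<le> M + V"
    using norm_triangle_ineq4[of p "p - z"] assms(6) by (simp add: V_def)
  then have "(norm z)\<^sup>2 \<le> (M + V)\<^sup>2" by (intro power_mono) auto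
  also have "\<dots> \<le> 2 * M\<^sup>2 + 2 * V\<^sup>2"
    using zero_le_power2[of "M - V"] by (simp add: power2_eq_square algebra_simps)
  finally have "(norm z)\<^sup>2 / (2 * \<gamma>) \<le> M\<^sup>2 / \<gamma> + V\<^sup>2 / \<gamma>"
    using \<open>0 < \<gamma>\<close> by (simp add: field_simps)
  moreover have "- (y \<bullet> (p - z)) \<le> B\<^sup>2 / 2 + V\<^sup>2 / 2"
  proof -
    have "- (y \<bullet> (p - z)) \<le> norm y * V"
      using Cauchy_Schwarz_ineq2[of y "p - z"] by (simp add: V_def)
    also have "\<dots> \<le> B * V" using assms(5) by (intro mult_right_mono) (auto simp: V_def)
    also have "\<dots> \<le> B\<^sup>2 / 2 + V\<^sup>2 / 2"
      using zero_le_power2[of "B - V"] by (simp add: power2_eq_square algebra_simps)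
    finally show ?thesis .
  qed
  moreover have "b \<le> r + (norm z)\<^sup>2 / (2 * \<gamma>)" using prox r by simp
  moreover have "r + y \<bullet> (p - z) + 1 / (2 * \<mu>) * V\<^sup>2 \<le> G"
    using descent r by (simp add: V_def)
  ultimately have "1 / (2 * \<mu>) * V\<^sup>2 \<le> (B\<^sup>2 / 2 + G - b + M\<^sup>2 / \<gamma>) + (1 / \<gamma> + 1 / 2) * V\<^sup>2"
    by (simp add: algebra_simps)
  then have "2 * \<mu> * (1 / (2 * \<mu>) * V\<^sup>2)
      \<le> 2 * \<mu> * ((B\<^sup>2 / 2 + G - b + M\<^sup>2 / \<gamma>) + (1 / \<gamma> + 1 / 2) * V\<^sup>2)"
    using \<open>0 < \<mu>\<close> by (intro mult_left_mono) auto
  then have "V\<^sup>2 \<le> 2 * \<mu> * (B\<^sup>2 / 2 + G - b + M\<^sup>2 / \<gamma>) + 2 * \<mu> * (1 / \<gamma> + 1 / 2) * V\<^sup>2"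
    using \<open>0 < \<mu>\<close> by (simp add: distrib_left distrib_right mult.assoc)
  moreover have "2 * \<mu> * (1 / \<gamma> + 1 / 2) * V\<^sup>2 \<le> 1 / 2 * V\<^sup>2"
    using small by (rule mult_right_mono) simp
  ultimately show ?thesis unfolding V_def by linarith
qed

section \<open>AKKT-stationarity of attentive limits\<close>

lemma attentive_tendsto_of_upper_bound:
  fixes h :: "'a::topological_space \<Rightarrow> ereal"
  assumes lsc: "lower_semicontinuous h" and Z: "Z \<longlonglongrightarrow> a" and fin: "\<bar>h a\<bar> \<noteq> \<infinity>"
    and upper: "\<forall>\<^sub>F k in sequentially. h (Z k) \<le> U k" "U \<longlonglongrightarrow> h a"
  shows "attentive_tendsto h Z a"
proof -
  have "(\<lambda>k. h (Z k)) \<longlonglongrightarrow> h a"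
  proof (rule order_tendstoI)
    fix l assume l: "l < h a"
    then have "\<forall>\<^sub>F q in at a. l < h q"
      using lsc unfolding lower_semicontinuous_def le_Liminf_iff by blast
    \<comment> \<open>Semicontinuity speaks of punctured neighbourhoods, but \<open>Z\<close> may take the value \<open>a\<close>.\<close>
    then have "\<forall>\<^sub>F q in nhds a. l < h q"
      using l by (auto simp: eventually_at_filter elim: eventually_mono)
    then show "\<forall>\<^sub>F k in sequentially. l < h (Z k)"
      using Z by (rule eventually_compose_filterlim)
  next
    fix u assume "h a < u"
    then have "\<forall>\<^sub>F k in sequentially. U k < u"
      using upper(2) order_tendstoD(2) by blast
    with upper(1) show "\<forall>\<^sub>F k in sequentially. h (Z k) < u"
      by eventually_elim simp
  qed
  then show ?thesis using Z fin by (simp add: attentive_tendsto_def)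
qed

theorem theorem3p6:
  fixes f :: "real^'n \<Rightarrow> real"
    and g :: "real^'m \<Rightarrow> ereal"
    and c :: "real^'n \<Rightarrow> real^'m"
    and \<theta> \<kappa> :: real
    and Y :: "(real^'m) set"
    and \<mu> \<epsilon> V :: "nat \<Rightarrow> real"
    and yh y z :: "nat \<Rightarrow> real^'m"
    and x :: "nat \<Rightarrow> real^'n"
    and xs :: "real^'n"
    and r :: "nat \<Rightarrow> nat"
  assumes "standing_assumptions f g c"
    and "safeguarded_ialm_run f g c 0 \<theta> \<kappa> Y \<mu> yh \<epsilon> x z y V"
    and "\<epsilon> \<longlonglongrightarrow> 0"
    and "strict_mono r"
    and "attentive_tendsto (composite_obj f g c) (x \<circ> r) xs"
  shows "AKKT_stationary f g c xs"
proof -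
  have f: "continuously_differentiable f" and c: "continuously_differentiable c"
    and lsc: "lower_semicontinuous g" and pb: "prox_bounded g"
    using assms(1) by (auto simp: standing_assumptions_def)
  have \<mu>0: "0 < \<mu> 0" and \<theta>: "0 < \<theta>" "\<theta> < 1" and \<kappa>: "0 < \<kappa>" "\<kappa> < 1" and Y: "bounded Y"
    and yhY: "\<And>k. yh k \<in> Y"
    and stat: "\<And>k. Upsilon_stationary f g c (\<mu> k) (yh k) (\<epsilon> k) (x k) (z k)"
    and y: "\<And>k. y k = yh k + inverse (\<mu> k) *\<^sub>R (c (x k) - z k)"
    and V: "\<And>k. V k = norm (c (x k) - z k)"
    and \<mu>_step: "\<And>k. \<mu> (Suc k) = (if k = 0 \<or> V k \<le> \<theta> * V (k - 1) then \<mu> k else \<kappa> * \<mu> k)"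
    using assms(2) by (auto simp: safeguarded_ialm_run_def)
  have V_nonneg: "0 \<le> V k" for k by (simp add: V)
  note \<mu>V = penalty_or_residual_tendsto_zero[OF \<mu>0 \<theta> \<kappa> V_nonneg \<mu>_step]
  have \<mu>: "0 < \<mu> k" for k by (rule \<mu>V(1))
  have sub: "filterlim r sequentially sequentially"
    using assms(4) by (rule filterlim_subseq)
  obtain B where B: "\<And>k. norm (yh k) \<le> B"
    using Y yhY by (meson bounded_iff)
  define X Z where "X = x \<circ> r" and "Z = z \<circ> r"

  have X: "X \<longlonglongrightarrow> xs" and \<phi>fin: "\<bar>composite_obj f g c xs\<bar> \<noteq> \<infinity>"
    and \<phi>: "(\<lambda>k. composite_obj f g c (X k)) \<longlonglongrightarrow> composite_obj f g c xs"
    using assms(5) by (auto simp: attentive_tendsto_def X_def)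
  have gfin: "\<bar>g (c xs)\<bar> \<noteq> \<infinity>"
    using \<phi>fin by (cases "g (c xs)") (auto simp: composite_obj_def)
  have cX: "(\<lambda>k. c (X k)) \<longlonglongrightarrow> c xs" and fX: "(\<lambda>k. f (X k)) \<longlonglongrightarrow> f xs"
    using X f c continuously_differentiable_tendsto by blast+
  \<comment> \<open>Subtracting the continuous \<open>f\<close> turns \<open>\<phi>\<close>-attentive convergence into convergence of \<open>g \<circ> c\<close>.\<close>
  have "(\<lambda>k. composite_obj f g c (X k) - ereal (f (X k)))
      \<longlonglongrightarrow> composite_obj f g c xs - ereal (f xs)"
    using \<phi> fX by (intro tendsto_diff_ereal_general) auto
  moreover have "composite_obj f g c u - ereal (f u) = g (c u)" for u
    by (cases "g (c u)") (auto simp: composite_obj_def)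
  ultimately have gcX: "(\<lambda>k. g (c (X k))) \<longlonglongrightarrow> g (c xs)" by simp

  have descent: "g (Z k) + ereal (yh (r k) \<bullet> (c (X k) - Z k)
      + 1 / (2 * \<mu> (r k)) * (norm (c (X k) - Z k))\<^sup>2) \<le> g (c (X k))" for k
    using stat[of "r k"] oracle_set_descent
    unfolding Upsilon_stationary_def X_def Z_def comp_def by blast

  have VZ: "(\<lambda>k. norm (c (X k) - Z k)) \<longlonglongrightarrow> 0"
    using \<mu>V(2)
  proof
    assume "V \<longlonglongrightarrow> 0"
    then have "(\<lambda>k. V (r k)) \<longlonglongrightarrow> 0" using sub by (rule filterlim_compose)
    then show ?thesis by (simp add: V X_def Z_def)
  next
    assume "\<mu> \<longlonglongrightarrow> 0"
    then have \<mu>r: "(\<lambda>k. \<mu> (r k)) \<longlonglongrightarrow> 0" using sub by (rule filterlim_compose)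
    obtain \<gamma> b where \<gamma>: "0 < \<gamma>" and b: "\<And>w. ereal b \<le> g w + ereal ((norm w)\<^sup>2 / (2 * \<gamma>))"
      using pb by (auto simp: prox_bounded_def prox_bounded_at_def)
    obtain M where M: "\<And>k. norm (c (X k)) \<le> M"
      using convergent_imp_Bseq[OF convergentI[OF cX]] by (auto simp: Bseq_def)
    \<comment> \<open>Any real \<open>G\<close> above the limit \<open>g (c xs)\<close> bounds \<open>g (c (X k))\<close> eventually; early iterates
      may be infeasible.\<close>
    obtain G where "g (c xs) < ereal G"
      using gfin ereal_dense2[of "g (c xs)" \<infinity>] by auto
    then have evG: "\<forall>\<^sub>F k in sequentially. g (c (X k)) < ereal G"
      using gcX order_tendstoD(2) by blast
    have "(\<lambda>k. 2 * \<mu> (r k) * (1 / \<gamma> + 1 / 2)) \<longlonglongrightarrow> 2 * 0 * (1 / \<gamma> + 1 / 2)"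
      by (intro tendsto_intros \<mu>r)
    then have ev\<mu>: "\<forall>\<^sub>F k in sequentially. 2 * \<mu> (r k) * (1 / \<gamma> + 1 / 2) < 1 / 2"
      by (rule order_tendstoD(2)) simp
    define C where "C = B\<^sup>2 / 2 + G - b + M\<^sup>2 / \<gamma>"
    have "\<forall>\<^sub>F k in sequentially. (norm (c (X k) - Z k))\<^sup>2 \<le> 4 * \<mu> (r k) * C"
      using evG ev\<mu>
    proof eventually_elim
      case (elim k)
      show ?case
        unfolding C_def
        by (rule penalised_residual_bound[OF \<mu> \<gamma> b _ B[of "r k"] M])
          (use elim order_trans[OF descent[of k], of "ereal G"] in auto)
    qed
    moreover have "(\<lambda>k. 4 * \<mu> (r k) * C) \<longlonglongrightarrow> 4 * 0 * C"
      by (intro tendsto_intros \<mu>r)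
    ultimately have "(\<lambda>k. (norm (c (X k) - Z k))\<^sup>2) \<longlonglongrightarrow> 0"
      using tendsto_sandwich[of "\<lambda>_. 0" "\<lambda>k. (norm (c (X k) - Z k))\<^sup>2" sequentially
          "\<lambda>k. 4 * \<mu> (r k) * C" 0]
      by simp
    then show ?thesis by simp
  qed
  then have cZ: "(\<lambda>k. c (X k) - Z k) \<longlonglongrightarrow> 0"
    by (simp add: tendsto_norm_zero_iff)
  have Z: "Z \<longlonglongrightarrow> c xs"
    using tendsto_diff[OF cX cZ] by simp

  have "attentive_tendsto g Z (c xs)"
  proof (rule attentive_tendsto_of_upper_bound[OF lsc Z gfin])
    have drop_penalty: "s \<le> t + ereal b" if "s + ereal (i + q) \<le> t" "- b \<le> i" "0 \<le> q"
      for s t :: ereal and i q b :: real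
      using that by (cases s; cases t) auto
    show "\<forall>\<^sub>F k in sequentially. g (Z k) \<le> g (c (X k)) + ereal (B * norm (c (X k) - Z k))"
    proof (intro always_eventually allI)
      fix k
      have "\<bar>yh (r k) \<bullet> (c (X k) - Z k)\<bar> \<le> norm (yh (r k)) * norm (c (X k) - Z k)"
        by (rule Cauchy_Schwarz_ineq2)
      also have "\<dots> \<le> B * norm (c (X k) - Z k)"
        using B by (intro mult_right_mono) auto
      finally have "- (B * norm (c (X k) - Z k)) \<le> yh (r k) \<bullet> (c (X k) - Z k)" by simp
      moreover have "0 \<le> 1 / (2 * \<mu> (r k)) * (norm (c (X k) - Z k))\<^sup>2"
        using \<mu>[of "r k"] by simp
      ultimately show "g (Z k) \<le> g (c (X k)) + ereal (B * norm (c (X k) - Z k))"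
        by (rule drop_penalty[OF descent])
    qed
    have "(\<lambda>k. g (c (X k)) + ereal (B * norm (c (X k) - Z k))) \<longlonglongrightarrow> g (c xs) + ereal (B * 0)"
      using gfin by (intro tendsto_add_ereal_general gcX tendsto_ereal tendsto_mult tendsto_const VZ) auto
    then show "(\<lambda>k. g (c (X k)) + ereal (B * norm (c (X k) - Z k))) \<longlonglongrightarrow> g (c xs)"
      by (simp add: zero_ereal_def[symmetric])
  qed
  moreover have "y k \<in> limiting_subdiff g (z k)"
    and res: "norm (gradient f (x k) + transpose (jacobian c (at (x k))) *v y k) \<le> \<epsilon> k" for k
  proof -
    obtain v where v: "norm v \<le> \<epsilon> k"
      "(v, 0) \<in> limiting_subdiff (\<lambda>(x', z'). aug_lagrangian f g c (\<mu> k) x' z' (yh k)) (x k, z k)"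
      using stat[of k] by (auto simp: Upsilon_stationary_def)
    have "\<mu> k \<noteq> 0" using \<mu>[of k] by simp
    from limiting_subdiff_aug_lagrangian[OF f c this v(2)] v(1)
    show "y k \<in> limiting_subdiff g (z k)"
      "norm (gradient f (x k) + transpose (jacobian c (at (x k))) *v y k) \<le> \<epsilon> k"
      by (auto simp: y)
  qed
  moreover have "(\<lambda>k. gradient f (X k) + transpose (jacobian c (at (X k))) *v (y \<circ> r) k) \<longlonglongrightarrow> 0"
  proof (rule Lim_null_comparison)
    show "(\<lambda>k. \<epsilon> (r k)) \<longlonglongrightarrow> 0"
      using assms(3) sub by (rule filterlim_compose)
    show "\<forall>\<^sub>F k in sequentially.
        norm (gradient f (X k) + transpose (jacobian c (at (X k))) *v (y \<circ> r) k) \<le> \<epsilon> (r k)"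
      using res by (intro always_eventually allI) (simp only: X_def comp_def)
  qed
  ultimately have "X \<longlonglongrightarrow> xs \<and> attentive_tendsto g Z (c xs) \<and>
      (\<lambda>k. gradient f (X k) + transpose (jacobian c (at (X k))) *v (y \<circ> r) k) \<longlonglongrightarrow> 0 \<and>
      (\<forall>k. (y \<circ> r) k \<in> limiting_subdiff g (Z k)) \<and> (\<lambda>k. c (X k) - Z k) \<longlonglongrightarrow> 0"
    using X cZ by (simp only: Z_def comp_apply simp_thms)
  then have "\<exists>x y z. x \<longlonglongrightarrow> xs \<and> attentive_tendsto g z (c xs) \<and>
      (\<lambda>k. gradient f (x k) + transpose (jacobian c (at (x k))) *v y k) \<longlonglongrightarrow> 0 \<and>
      (\<forall>k. y k \<in> limiting_subdiff g (z k)) \<and> (\<lambda>k. c (x k) - z k) \<longlonglongrightarrow> 0"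
    by (rule exI[of _ X, OF exI[of _ "y \<circ> r", OF exI[of _ Z]]])
  moreover have "feasible g c xs"
    using gfin by (auto simp: feasible_def edom_def)
  ultimately show ?thesis
    unfolding AKKT_stationary_def by (rule conjI[rotated])
qed

end
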